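(* Let $x \in (0,1)$ be fixed. For each positive integer $n$ let $K_n(x,\cdot)$ be the Bernstein-Durrmeyer kernel at $x$, regarded as a function on $\mathbb{R}$ that vanishes outside $[0,1]$. Then the probability distributions on $\mathbb{R}$ given by $$\frac{1}{\sqrt{n}}\,K_n\!\left(x, \frac{t}{\sqrt{n}} + x\right) dt$$ converge in distribution, as $n \to \infty$, to the normal distribution $N(0, 2x(1-x))$ with mean $0$ and variance $2x(1-x)$.
   Context: For integers $0 \le k \le n$, let $p_{n,k}(t) = \binom{n}{k} t^k (1-t)^{n-k}$ for $t \in [0,1]$ and $p_{n,k}(t) = 0$ for $t \in \mathbb{R}\setminus[0,1]$. The Bernstein-Durrmeyer kernel is $$K_n(x,t) = (n+1)\sum_{k=0}^n p_{n,k}(x)\,p_{n,k}(t), \qquad x \in [0,1],\ t \in \mathbb{R}.$$ For each $x \in [0,1]$, $K_n(x,t)\,dt$ is a probability distribution supported on $[0,1]$. $N(\mu,\sigma^2)$ denotes the normal distribution with mean $\mu$ and variance $\sigma^2$. *)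

theory Defs
  imports "HOL-Probability.Probability"
begin

definition bernstein_basis :: "nat \<Rightarrow> nat \<Rightarrow> real \<Rightarrow> real" where
  "bernstein_basis n k t = (if t \<in> {0..1} then Bernstein n k t else 0)"

definition durrmeyer_kernel :: "nat \<Rightarrow> real \<Rightarrow> real \<Rightarrow> real" where
  "durrmeyer_kernel n x t =
     (real n + 1) * (\<Sum>k=0..n. bernstein_basis n k x * bernstein_basis n k t)"

text \<open>For \<open>n = 0\<close> this is the zero measure, since \<open>1 / sqrt 0 = 0\<close> in HOL.\<close>

definition scaled_durrmeyer :: "nat \<Rightarrow> real \<Rightarrow> real measure" where
  "scaled_durrmeyer n x =
     density lborel (\<lambda>t. ennreal (1 / sqrt (real n) * durrmeyer_kernel n x (t / sqrt (real n) + x)))"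

lemma bernstein_basis_nonneg: "0 \<le> bernstein_basis n k t"
  by (simp add: bernstein_basis_def Bernstein_nonneg)

lemma borel_measurable_bernstein_basis [measurable]:
  "bernstein_basis n k \<in> borel_measurable borel"
  unfolding bernstein_basis_def[abs_def] Bernstein_def by measurable

lemma durrmeyer_kernel_nonneg: "0 \<le> durrmeyer_kernel n x t"
  by (simp add: durrmeyer_kernel_def bernstein_basis_nonneg sum_nonneg)

lemma borel_measurable_durrmeyer_kernel [measurable]:
  "durrmeyer_kernel n x \<in> borel_measurable borel"
  unfolding durrmeyer_kernel_def[abs_def] by measurable

lemma has_integral_Bernstein:
  assumes "k \<le> n"
  shows "(Bernstein n k has_integral 1 / (real n + 1)) {0..1}"
proof -
  have "((\<lambda>t. t powr (real (Suc k) - 1) * (1 - t) powr (real (Suc (n - k)) - 1))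
      has_integral Beta (real (Suc k)) (real (Suc (n - k)))) {0..1}"
    by (rule has_integral_Beta_real) auto
  then have "((\<lambda>t. t ^ k * (1 - t) ^ (n - k))
      has_integral Beta (real (Suc k)) (real (Suc (n - k)))) {0..1}"
    by (rule has_integral_spike[of "{0, 1}", rotated 2]) (auto simp: powr_realpow)
  then have "((\<lambda>t. real (n choose k) * (t ^ k * (1 - t) ^ (n - k))) has_integral
      real (n choose k) * Beta (real (Suc k)) (real (Suc (n - k)))) {0..1}"
    by (rule has_integral_mult_right)
  moreover have "real (n choose k) * Beta (real (Suc k)) (real (Suc (n - k))) = 1 / (real n + 1)"
  proof -
    have "Beta (real (Suc k)) (real (Suc (n - k))) = fact k * fact (n - k) / fact (Suc n)"
      using assms Gamma_fact[of k, where 'a = real] Gamma_fact[of "n - k", where 'a = real]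
        Gamma_fact[of "Suc n", where 'a = real]
      by (simp add: Beta_def of_nat_diff add.commute add.left_commute)
    moreover have "real (n choose k) = fact n / (fact k * fact (n - k))"
      using assms by (rule binomial_fact)
    moreover have "fact (Suc n) = (real n + 1) * fact n"
      by simp
    ultimately show ?thesis
      by (simp del: fact_Suc of_nat_Suc)
  qed
  ultimately show ?thesis
    by (simp add: Bernstein_def[abs_def] mult.assoc)
qed

lemma nn_integral_bernstein_basis:
  assumes "k \<le> n"
  shows "(\<integral>\<^sup>+t. ennreal (bernstein_basis n k t) \<partial>lborel) = ennreal (1 / (real n + 1))"
proof (rule nn_integral_has_integral_lborel)
  have "((\<lambda>t. if t \<in> {0..1} then Bernstein n k t else 0) has_integral 1 / (real n + 1)) UNIV"
    using has_integral_Bernstein[OF assms] by (subst has_integral_restrict_UNIV)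
  then show "(bernstein_basis n k has_integral 1 / (real n + 1)) UNIV"
    by (simp add: bernstein_basis_def[abs_def])
qed (auto simp: bernstein_basis_nonneg)

lemma nn_integral_durrmeyer_kernel:
  assumes "x \<in> {0..1}"
  shows "(\<integral>\<^sup>+t. ennreal (durrmeyer_kernel n x t) \<partial>lborel) = 1"
proof -
  have "(\<integral>\<^sup>+t. ennreal (durrmeyer_kernel n x t) \<partial>lborel) =
    (\<integral>\<^sup>+t. (\<Sum>k=0..n. ennreal ((real n + 1) * bernstein_basis n k x) * ennreal (bernstein_basis n k t)) \<partial>lborel)"
    by (intro nn_integral_cong)
      (simp add: durrmeyer_kernel_def bernstein_basis_nonneg sum_distrib_left mult.assoc
        flip: ennreal_mult' sum_ennreal)
  also have "\<dots> = (\<Sum>k=0..n. ennreal ((real n + 1) * bernstein_basis n k x) * ennreal (1 / (real n + 1)))"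
    by (subst nn_integral_sum) (auto simp: nn_integral_cmult nn_integral_bernstein_basis)
  also have "\<dots> = (\<Sum>k=0..n. ennreal (bernstein_basis n k x))"
  proof (intro sum.cong refl)
    fix k
    have "(real n + 1) * bernstein_basis n k x * (1 / (real n + 1)) = bernstein_basis n k x"
      by simp
    then show "ennreal ((real n + 1) * bernstein_basis n k x) * ennreal (1 / (real n + 1)) =
        ennreal (bernstein_basis n k x)"
      by (metis ennreal_mult'' of_nat_0_le_iff add_nonneg_nonneg zero_le_one zero_le_divide_1_iff)
  qed
  also have "\<dots> = ennreal (\<Sum>k=0..n. bernstein_basis n k x)"
    by (simp add: bernstein_basis_nonneg)
  also have "(\<Sum>k=0..n. bernstein_basis n k x) = 1"
    using assms sum_Bernstein[of n x] by (simp add: bernstein_basis_def atMost_atLeast0)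
  finally show ?thesis by simp
qed

lemma real_distribution_scaled_durrmeyer:
  assumes "x \<in> {0..1}" and "n > 0"
  shows "real_distribution (scaled_durrmeyer n x)"
proof -
  let ?c = "1 / sqrt (real n)"
  have "emeasure (scaled_durrmeyer n x) (space (scaled_durrmeyer n x)) =
      (\<integral>\<^sup>+t. ennreal (?c * durrmeyer_kernel n x (t / sqrt (real n) + x)) \<partial>lborel)"
    by (simp add: scaled_durrmeyer_def emeasure_density)
  also have "\<dots> = ennreal \<bar>?c\<bar> * (\<integral>\<^sup>+t. ennreal (durrmeyer_kernel n x (x + ?c * t)) \<partial>lborel)"
    by (subst nn_integral_cmult[symmetric]; (intro nn_integral_cong)?)
      (auto simp: ennreal_mult'[symmetric] add.commute)
  also have "\<dots> = (\<integral>\<^sup>+t. ennreal (durrmeyer_kernel n x t) \<partial>lborel)"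
    using assms by (intro nn_integral_real_affine[symmetric]) auto
  also have "\<dots> = 1"
    by (rule nn_integral_durrmeyer_kernel[OF assms(1)])
  finally have "prob_space (scaled_durrmeyer n x)"
    by (rule prob_spaceI)
  then show ?thesis
    by (simp add: real_distribution_def real_distribution_axioms_def scaled_durrmeyer_def)
qed

end

theory Submission
  imports Defs "HOL-Real_Asymp.Real_Asymp"
begin

text \<open>
  The distribution function of \<open>K\<^sub>n(x, \<cdot>)\<close> at \<open>t\<close> is the probability that \<open>J > K\<close> for independent
  binomial variables \<open>J\<close> and \<open>K\<close> with parameters \<open>(n + 1, t)\<close> and \<open>(n, x)\<close>. For \<open>t = x + s / sqrt n\<close>
  the characteristic function of \<open>(K - J) / sqrt n + s\<close> is explicit and converges to that of the
  normal distribution with variance \<open>2x(1 - x)\<close>, so by Levy's continuity theorem the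
  probability that this variable is less than \<open>s\<close> converges.
\<close>

section \<open>The distribution function of the Bernstein-Durrmeyer kernel\<close>

text \<open>The identities \<open>a\<close> and \<open>b\<close> absorb the factors produced by
  differentiation into binomial coefficients of degree \<open>n\<close>. Indexing by
  \<open>Suc j\<close> avoids a separate case for index 0.\<close>

lemma DERIV_Bernstein_Suc_Suc:
  "(Bernstein (Suc n) (Suc j) has_real_derivative
     (real n + 1) * (Bernstein n j t - Bernstein n (Suc j) t)) (at t within A)"
proof -
  have a: "real (Suc j) * real (Suc n choose Suc j) = (real n + 1) * real (n choose j)"
    using arg_cong[OF Suc_times_binomial[of j n], of real] by (simp only: of_nat_mult of_nat_Suc add.commute)
  have b: "real (n - j) * real (Suc n choose Suc j) = (real n + 1) * real (n choose Suc j)"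
    using arg_cong[OF binomial_absorb_comp[of "Suc n" "Suc j"], of real]
    by (simp only: of_nat_mult of_nat_Suc diff_Suc_Suc diff_Suc_1 add.commute)
  have "(Bernstein (Suc n) (Suc j) has_real_derivative
     real (Suc n choose Suc j) * (real (Suc j) * t ^ j * (1 - t) ^ (n - j)
       - t ^ Suc j * (real (n - j) * (1 - t) ^ (n - Suc j)))) (at t within A)"
    unfolding Bernstein_def[abs_def]
    by (rule derivative_eq_intros refl | simp add: algebra_simps del: binomial_Suc_Suc)+
  also have "real (Suc n choose Suc j) * (real (Suc j) * t ^ j * (1 - t) ^ (n - j)
       - t ^ Suc j * (real (n - j) * (1 - t) ^ (n - Suc j))) =
     (real (Suc j) * real (Suc n choose Suc j)) * (t ^ j * (1 - t) ^ (n - j))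
     - (real (n - j) * real (Suc n choose Suc j)) * (t ^ Suc j * (1 - t) ^ (n - Suc j))"
    by (simp only: algebra_simps)
  also have "\<dots> = (real n + 1) * (Bernstein n j t - Bernstein n (Suc j) t)"
    unfolding a b Bernstein_def by (simp only: algebra_simps)
  finally show ?thesis .
qed

text \<open>The derivatives of the summands telescope to the single term of index \<open>k\<close>,
  because \<open>Bernstein n (Suc n)\<close> is zero. The tail sum is thus an antiderivative, and it
  vanishes at 0.\<close>

lemma has_integral_Bernstein_Icc:
  assumes "k \<le> n" "0 \<le> t"
  shows "((\<lambda>u. (real n + 1) * Bernstein n k u) has_integral
           (\<Sum>j=k..n. Bernstein (Suc n) (Suc j) t)) {0..t}"
proof -
  have tel: "(\<Sum>j=k..n. Bernstein n j u - Bernstein n (Suc j) u) = Bernstein n k u" for u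
    using sum_telescope''[of k "Suc n" "\<lambda>j. - Bernstein n j u"] assms(1)
      sum_Suc_diff[of k "n" "\<lambda>j. - Bernstein n j u"]
    by (simp add: Bernstein_def[of n "Suc n"])
  have "((\<lambda>t. \<Sum>j=k..n. Bernstein (Suc n) (Suc j) t) has_real_derivative
      (real n + 1) * Bernstein n k u) (at u within {0..t})" for u
    unfolding tel[symmetric] sum_distrib_left by (intro DERIV_sum DERIV_Bernstein_Suc_Suc)
  then have "((\<lambda>u. (real n + 1) * Bernstein n k u) has_integral
      (\<Sum>j=k..n. Bernstein (Suc n) (Suc j) t) - (\<Sum>j=k..n. Bernstein (Suc n) (Suc j) 0)) {0..t}"
    by (intro fundamental_theorem_of_calculus assms)
      (auto simp: has_real_derivative_iff_has_vector_derivative)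
  then show ?thesis
    by (simp add: Bernstein_def)
qed

text \<open>Both supports are finite, so the integral is a finite sum. The general range type covers
  real indicators as well as complex exponentials.\<close>

lemma expectation_pair_binomial_pmf:
  fixes f :: "nat \<times> nat \<Rightarrow> 'b::{banach, second_countable_topology}"
  assumes "p \<in> {0..1}" "q \<in> {0..1}"
  shows "measure_pmf.expectation (pair_pmf (binomial_pmf m p) (binomial_pmf n q)) f =
    (\<Sum>j\<le>m. \<Sum>k\<le>n. (Bernstein m j p * Bernstein n k q) *\<^sub>R f (j, k))"
proof -
  have "measure_pmf.expectation (pair_pmf (binomial_pmf m p) (binomial_pmf n q)) f =
      (\<Sum>z\<in>{..m} \<times> {..n}. pmf (pair_pmf (binomial_pmf m p) (binomial_pmf n q)) z *\<^sub>R f z)"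
    using assms
    by (intro integral_measure_pmf) (auto simp: set_pmf_binomial_eq split: if_splits)
  then show ?thesis
    using assms by (auto simp: sum.cartesian_product pmf_pair Bernstein_def intro!: sum.cong)
qed

text \<open>Conditionally on \<open>k\<close>, the kernel is the density of the \<open>k + 1\<close>-st order statistic of
  \<open>n + 1\<close> uniform variables, which is at most \<open>t\<close> iff at least \<open>k + 1\<close> of them are.\<close>

lemma cdf_scaled_durrmeyer:
  fixes x s :: real
  assumes x: "x \<in> {0..1}" and n: "n > 0" and t: "x + s / sqrt (real n) \<in> {0..1}"
  shows "cdf (scaled_durrmeyer n x) s =
    measure_pmf.prob
      (pair_pmf (binomial_pmf (Suc n) (x + s / sqrt (real n))) (binomial_pmf n x)) {(j, k). k < j}"
proof -
  define t where "t = x + s / sqrt (real n)"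
  define F where "F = (\<Sum>k=0..n. Bernstein n k x * (\<Sum>j=k..n. Bernstein (Suc n) (Suc j) t))"
  let ?c = "1 / sqrt (real n)"
  have t01: "0 \<le> t" "t \<le> 1" using t by (auto simp: t_def)
  have F0: "0 \<le> F"
    unfolding F_def using x t01 by (intro sum_nonneg mult_nonneg_nonneg Bernstein_nonneg) auto
  have "((\<lambda>u. \<Sum>k=0..n. Bernstein n k x * ((real n + 1) * Bernstein n k u)) has_integral F) {0..t}"
    unfolding F_def
    by (intro has_integral_sum has_integral_mult_right has_integral_Bernstein_Icc t01) auto
  then have "((\<lambda>u. durrmeyer_kernel n x u) has_integral F) {0..t}"
    by (rule has_integral_eq[rotated])
      (use x t01 in \<open>auto simp: durrmeyer_kernel_def bernstein_basis_def sum_distrib_left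
        mult_ac intro!: sum.cong\<close>)
  then have "((\<lambda>u. durrmeyer_kernel n x u * indicator {..t} u) has_integral F) {0..t}"
    by (rule has_integral_eq[rotated]) auto
  \<comment> \<open>The kernel vanishes to the left of 0 and the indicator to the right of
    \<open>t\<close>.\<close>
  then have hi: "((\<lambda>u. durrmeyer_kernel n x u * indicator {..t} u) has_integral F) UNIV"
    by (rule has_integral_on_superset)
      (auto simp: durrmeyer_kernel_def bernstein_basis_def indicator_def)
  have "emeasure (scaled_durrmeyer n x) {..s} =
      (\<integral>\<^sup>+u. ennreal (?c * durrmeyer_kernel n x (u / sqrt (real n) + x)) * indicator {..s} u \<partial>lborel)"
    unfolding scaled_durrmeyer_def by (subst emeasure_density) auto
  also have "\<dots> = ennreal \<bar>?c\<bar> *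
      (\<integral>\<^sup>+u. ennreal (durrmeyer_kernel n x (x + ?c * u) * indicator {..t} (x + ?c * u)) \<partial>lborel)"
    using n by (subst nn_integral_cmult[symmetric]; (intro nn_integral_cong)?)
      (auto simp: ennreal_mult'[symmetric] add.commute t_def indicator_def divide_le_cancel)
  also have "\<dots> = (\<integral>\<^sup>+u. ennreal (durrmeyer_kernel n x u * indicator {..t} u) \<partial>lborel)"
    using n by (intro nn_integral_real_affine[symmetric]) auto
  also have "\<dots> = ennreal F"
    by (rule nn_integral_has_integral_lborel[OF _ _ hi]) (auto simp: durrmeyer_kernel_nonneg)
  finally have "cdf (scaled_durrmeyer n x) s = F"
    unfolding cdf_def measure_def using F0 by simp
  \<comment> \<open>The triangle of indices is extended to a square by an indicator, so that the two
    sums can be swapped.\<close>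
  also have "F = (\<Sum>k\<le>n. \<Sum>j\<le>n. Bernstein (Suc n) (Suc j) t * Bernstein n k x * indicator {k..} j)"
    unfolding F_def sum_distrib_left atMost_atLeast0
    by (intro sum.cong refl sum.mono_neutral_cong_left) auto
  also have "\<dots> = (\<Sum>j\<le>n. \<Sum>k\<le>n. Bernstein (Suc n) (Suc j) t * Bernstein n k x * indicator {k..} j)"
    by (rule sum.swap)
  \<comment> \<open>Replacing \<open>Suc j\<close> by \<open>j\<close> turns
    \<open>k \<le> j\<close> into \<open>k < j\<close>; the new term with \<open>j = 0\<close>
    contributes nothing.\<close>
  also have "\<dots> = (\<Sum>j\<le>Suc n. \<Sum>k\<le>n. (Bernstein (Suc n) j t * Bernstein n k x) *\<^sub>R
      indicator {(j, k). k < j} (j, k))"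
    by (subst sum.atMost_Suc_shift) (auto simp: indicator_def less_Suc_eq_le intro!: sum.cong)
  also have "\<dots> = measure_pmf.expectation (pair_pmf (binomial_pmf (Suc n) t) (binomial_pmf n x))
      (indicator {(j, k). k < j})"
    using x t01 by (subst expectation_pair_binomial_pmf) auto
  also have "\<dots> = measure_pmf.prob (pair_pmf (binomial_pmf (Suc n) t) (binomial_pmf n x)) {(j, k). k < j}"
    by simp
  finally show ?thesis by (simp add: t_def)
qed

section \<open>Characteristic functions\<close>

lemma sum_Bernstein_power:
  fixes z :: complex
  shows "(\<Sum>k\<le>n. of_real (Bernstein n k p) * z ^ k) = (of_real (1 - p) + of_real p * z) ^ n"
  using binomial_ring[of "of_real p * z" "1 - of_real p" n]
  by (simp add: Bernstein_def power_mult_distrib mult_ac add.commute)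

text \<open>The comparison sequence \<open>w n = exp (L / n)\<close> has the limit as its exact
  \<open>n\<close>-th power for \<open>n > 0\<close>. Both bases lie in the closed unit disc (this
  uses \<open>L \<le> 0\<close>), so the \<open>n\<close>-th powers differ by at most
  \<open>n\<close> times the distance of the bases, which tends to 0. No complex logarithm is
  involved.\<close>

lemma tendsto_power_exp:
  fixes b :: "nat \<Rightarrow> complex"
  assumes lim: "(\<lambda>n. of_nat n * (b n - 1)) \<longlonglongrightarrow> of_real L"
    and norm: "\<forall>\<^sub>F n in sequentially. norm (b n) \<le> 1" and L: "L \<le> 0"
  shows "(\<lambda>n. b n ^ n) \<longlonglongrightarrow> exp (of_real L)"
proof -
  define w where "w n = exp (of_real (L / real n) :: complex)" for n
  have "(\<lambda>n. real n * (exp (L / real n) - 1)) \<longlonglongrightarrow> L"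
    by real_asymp
  then have "(\<lambda>n. of_real (real n * (exp (L / real n) - 1)) :: complex) \<longlonglongrightarrow> of_real L"
    by (rule tendsto_of_real)
  then have "(\<lambda>n. of_nat n * (b n - 1) - of_nat n * (w n - 1)) \<longlonglongrightarrow> of_real L - of_real L"
    unfolding w_def exp_of_real by (intro tendsto_diff lim) simp
  then have 0: "(\<lambda>n. norm (of_nat n * (b n - 1) - of_nat n * (w n - 1))) \<longlonglongrightarrow> 0"
    by (simp add: tendsto_norm_zero_iff)
  have "(\<lambda>n. b n ^ n - exp (of_real L)) \<longlonglongrightarrow> 0"
  proof (rule Lim_null_comparison[OF _ 0])
    show "\<forall>\<^sub>F n in sequentially. norm (b n ^ n - exp (of_real L))
        \<le> norm (of_nat n * (b n - 1) - of_nat n * (w n - 1))"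
      using norm eventually_gt_at_top[of 0]
    proof eventually_elim
      case (elim n)
      have "w n ^ n = exp (of_real L)"
        using elim by (simp add: w_def flip: exp_of_nat_mult)
      moreover have "norm (w n) \<le> 1"
        using L by (simp add: w_def divide_nonpos_nonneg)
      then have "norm (b n ^ n - w n ^ n) \<le> n * norm (b n - w n)"
        using elim by (intro norm_power_diff)
      moreover have "of_nat n * (b n - 1) - of_nat n * (w n - 1) = of_nat n * (b n - w n)"
        by (simp add: algebra_simps)
      ultimately show ?case
        by (simp add: norm_mult)
    qed
  qed
  then show ?thesis
    by (rule LIM_zero_cancel)
qed

section \<open>Centered Bernoulli variables\<close>

text \<open>For \<open>p\<close> in [0,1] this is the characteristic function at \<open>h\<close> of
  X - p, where X is Bernoulli with parameter \<open>p\<close>.\<close>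

definition centered_bernoulli_char :: "real \<Rightarrow> real \<Rightarrow> complex" where
  "centered_bernoulli_char p h = (1 - p) * iexp (- (p * h)) + p * iexp ((1 - p) * h)"

lemma centered_bernoulli_char_eq:
  "centered_bernoulli_char p h = (1 - p + p * iexp h) * iexp (- (p * h))"
  by (simp add: centered_bernoulli_char_def algebra_simps flip: exp_add)

lemma norm_centered_bernoulli_char_le:
  assumes "p \<in> {0..1}"
  shows "norm (centered_bernoulli_char p h) \<le> 1"
proof -
  have "norm (1 - complex_of_real p) = \<bar>1 - p\<bar>"
    using norm_of_real[of "1 - p", where 'a = complex] by simp
  then have "norm (centered_bernoulli_char p h) \<le> norm (1 - p) * 1 + norm p * 1"
    unfolding centered_bernoulli_char_def
    by (intro norm_triangle_le add_mono) (auto simp: norm_mult)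
  with assms show ?thesis by auto
qed

text \<open>Both exponentials are expanded to second order. The linear terms cancel because the mean
  is 0, and the quadratic terms combine to the variance \<open>p * (1 - p)\<close>. The crude error
  bound is uniform in \<open>p\<close>, which allows \<open>p\<close> to vary with \<open>n\<close>
  later.\<close>

lemma centered_bernoulli_char_approx:
  assumes "p \<in> {0..1}"
  shows "norm (centered_bernoulli_char p h - (1 - p * (1 - p) * h\<^sup>2 / 2)) \<le> \<bar>h\<bar> ^ 3"
proof -
  let ?T = "\<lambda>y::real. 1 + \<i> * y - y\<^sup>2 / 2 :: complex"
  have T: "norm (iexp y - ?T y) \<le> \<bar>h\<bar> ^ 3" if "\<bar>y\<bar> \<le> \<bar>h\<bar>" for y
  proof -
    have "norm (iexp y - ?T y) \<le> \<bar>y\<bar> ^ 3 / 6"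
      using iexp_approx1[of y 2] by (simp add: numeral_eq_Suc power_mult_distrib algebra_simps)
    also have "\<dots> \<le> \<bar>y\<bar> ^ 3" by simp
    also have "\<dots> \<le> \<bar>h\<bar> ^ 3" using that by (intro power_mono) auto
    finally show ?thesis .
  qed
  have y: "\<bar>- (p * h)\<bar> \<le> \<bar>h\<bar>" "\<bar>(1 - p) * h\<bar> \<le> \<bar>h\<bar>"
    using assms by (auto simp: abs_mult intro!: mult_left_le_one_le)
  have "centered_bernoulli_char p h - (1 - p * (1 - p) * h\<^sup>2 / 2) =
      (1 - p) * (iexp (- (p * h)) - ?T (- (p * h))) + p * (iexp ((1 - p) * h) - ?T ((1 - p) * h))"
    by (simp add: centered_bernoulli_char_def field_simps power2_eq_square)
  also have "norm \<dots> \<le> norm (1 - p) * \<bar>h\<bar> ^ 3 + norm p * \<bar>h\<bar> ^ 3"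
    by (intro order_trans[OF norm_triangle_ineq] add_mono; unfold norm_mult norm_of_real real_norm_def;
      intro mult_left_mono T y abs_ge_zero)
  also have "\<dots> = \<bar>h\<bar> ^ 3" using assms by (auto simp: algebra_simps)
  finally show ?thesis .
qed

text \<open>This is a central limit theorem for a triangular array: the success probability may move
  with \<open>n\<close>, as it does for \<open>x + s / sqrt n\<close>.\<close>

lemma tendsto_centered_bernoulli_char_power:
  assumes p: "\<forall>\<^sub>F n in sequentially. p n \<in> {0..1}" "p \<longlonglongrightarrow> q" and q: "q \<in> {0..1}"
  shows "(\<lambda>n. centered_bernoulli_char (p n) (u / sqrt (real n)) ^ n)
    \<longlonglongrightarrow> exp (of_real (- (q * (1 - q) * u\<^sup>2 / 2)))"
proof (rule tendsto_power_exp)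
  define h where "h n = u / sqrt (real n)" for n
  let ?g = "\<lambda>n. centered_bernoulli_char (p n) (h n)"
  have "(\<lambda>n. of_nat n * (?g n - (1 - p n * (1 - p n) * (h n)\<^sup>2 / 2))) \<longlonglongrightarrow> 0"
  proof (rule Lim_null_comparison)
    show "\<forall>\<^sub>F n in sequentially. norm (of_nat n * (?g n - (1 - p n * (1 - p n) * (h n)\<^sup>2 / 2)))
        \<le> \<bar>u\<bar> ^ 3 * (real n * (1 / sqrt (real n)) ^ 3)"
      using p(1)
    proof eventually_elim
      case (elim n)
      have "norm (of_nat n * (?g n - (1 - p n * (1 - p n) * (h n)\<^sup>2 / 2))) \<le> real n * \<bar>h n\<bar> ^ 3"
        using centered_bernoulli_char_approx[OF elim, of "h n"]
        by (auto simp: norm_mult intro!: mult_left_mono)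
      then show ?case by (simp add: h_def power_divide mult.commute)
    qed
    have "(\<lambda>n. real n * (1 / sqrt (real n)) ^ 3) \<longlonglongrightarrow> 0" by real_asymp
    then show "(\<lambda>n. \<bar>u\<bar> ^ 3 * (real n * (1 / sqrt (real n)) ^ 3)) \<longlonglongrightarrow> 0"
      by (rule tendsto_mult_right_zero)
  qed
  moreover have "(\<lambda>n. of_real (- (p n * (1 - p n) * u\<^sup>2 / 2)) :: complex)
      \<longlonglongrightarrow> of_real (- (q * (1 - q) * u\<^sup>2 / 2))"
    by (intro tendsto_intros p) auto
  ultimately have "(\<lambda>n. of_nat n * (?g n - (1 - p n * (1 - p n) * (h n)\<^sup>2 / 2)) +
      of_real (- (p n * (1 - p n) * u\<^sup>2 / 2))) \<longlonglongrightarrow> 0 + of_real (- (q * (1 - q) * u\<^sup>2 / 2))"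
    by (rule tendsto_add)
  \<comment> \<open>The cancellation rests on \<open>n * (h n)\<^sup>2 = u\<^sup>2\<close>, which
    can fail at \<open>n = 0\<close>, where \<open>h n\<close> is 0.\<close>
  moreover have "\<forall>\<^sub>F n in sequentially. of_nat n * (?g n - (1 - p n * (1 - p n) * (h n)\<^sup>2 / 2)) +
      of_real (- (p n * (1 - p n) * u\<^sup>2 / 2)) = of_nat n * (?g n - 1)"
    using eventually_gt_at_top[of 0]
  proof eventually_elim
    case (elim n)
    have "of_nat n * complex_of_real ((h n)\<^sup>2) = of_real (u\<^sup>2)"
      using elim by (simp add: h_def power_divide flip: of_real_power)
    moreover have "of_nat n * (?g n - (1 - p n * (1 - p n) * (h n)\<^sup>2 / 2)) +
        of_real (- (p n * (1 - p n) * u\<^sup>2 / 2)) = of_nat n * (?g n - 1) +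
        p n * (1 - p n) * (of_nat n * complex_of_real ((h n)\<^sup>2) - of_real (u\<^sup>2)) / 2"
      by (simp add: field_simps)
    ultimately show ?case by simp
  qed
  ultimately show "(\<lambda>n. of_nat n * (centered_bernoulli_char (p n) (u / sqrt (real n)) - 1))
      \<longlonglongrightarrow> of_real (- (q * (1 - q) * u\<^sup>2 / 2))"
    unfolding h_def by (simp add: filterlim_cong)
  show "\<forall>\<^sub>F n in sequentially. norm (centered_bernoulli_char (p n) (u / sqrt (real n))) \<le> 1"
    using p(1) by eventually_elim (rule norm_centered_bernoulli_char_le)
  show "- (q * (1 - q) * u\<^sup>2 / 2) \<le> 0"
    using q by auto
qed

section \<open>The normal law and the difference of binomial variables\<close>

lemma normal_density_eq_distr_std_normal:
  assumes "\<sigma> > 0"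
  shows "density lborel (normal_density 0 \<sigma>) = distr std_normal_distribution borel (\<lambda>x. \<sigma> * x)"
proof -
  interpret prob_space std_normal_distribution
    by (rule prob_space_normal_density) simp
  have "distributed std_normal_distribution lborel (\<lambda>x. x) std_normal_density"
    by (auto simp: distributed_def distr_id2)
  from normal_density_affine[OF this, of \<sigma> 0] show ?thesis
    using assms by (simp add: distributed_def cong: distr_cong)
qed

lemma char_normal_density:
  assumes "\<sigma> > 0"
  shows "char (density lborel (normal_density 0 \<sigma>)) u = exp (of_real (- (\<sigma>\<^sup>2 * u\<^sup>2 / 2)))"
proof -
  have "char (density lborel (normal_density 0 \<sigma>)) u = char std_normal_distribution (\<sigma> * u)"
    unfolding normal_density_eq_distr_std_normal[OF assms] char_def
    by (subst integral_distr) (auto simp: mult_ac)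
  then show ?thesis
    unfolding exp_of_real by (simp add: char_std_normal_distribution power_mult_distrib)
qed

text \<open>By independence the function is a product of binomial generating functions. The shift
  \<open>d\<close> exactly centers \<open>n\<close> trials of each variable; the one extra trial of
  the first variable remains uncentered and gives the last factor.\<close>

lemma char_binomial_difference:
  fixes x t c d u :: real
  assumes "t \<in> {0..1}" "x \<in> {0..1}" and d: "d = c * (n * (t - x))"
  shows "char (distr (measure_pmf (pair_pmf (binomial_pmf (Suc n) t) (binomial_pmf n x))) borel
       (\<lambda>(j, k). c * (real k - real j) + d)) u =
    centered_bernoulli_char t (- (c * u)) ^ n * centered_bernoulli_char x (c * u) ^ n *
      (1 - t + t * iexp (- (c * u)))"
proof -
  let ?h = "c * u"
  let ?z = "iexp ?h" and ?w = "iexp (- ?h)"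
  have "char (distr (measure_pmf (pair_pmf (binomial_pmf (Suc n) t) (binomial_pmf n x))) borel
       (\<lambda>(j, k). c * (real k - real j) + d)) u =
     (\<Sum>j\<le>Suc n. \<Sum>k\<le>n. (Bernstein (Suc n) j t * Bernstein n k x) *\<^sub>R
       iexp (u * (c * (real k - real j) + d)))"
    unfolding char_def using assms
    by (subst integral_distr; (subst expectation_pair_binomial_pmf)?) auto
  also have "\<dots> = (\<Sum>j\<le>Suc n. \<Sum>k\<le>n. iexp (u * d) *
      ((of_real (Bernstein (Suc n) j t) * ?w ^ j) * (of_real (Bernstein n k x) * ?z ^ k)))"
  proof (intro sum.cong refl)
    fix j k
    have "iexp (u * (c * (real k - real j) + d)) = iexp (u * d) * (?w ^ j * ?z ^ k)"
      by (simp add: algebra_simps flip: exp_add exp_of_nat_mult)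
    then show "(Bernstein (Suc n) j t * Bernstein n k x) *\<^sub>R iexp (u * (c * (real k - real j) + d)) =
      iexp (u * d) * ((of_real (Bernstein (Suc n) j t) * ?w ^ j) * (of_real (Bernstein n k x) * ?z ^ k))"
      by (simp add: scaleR_conv_of_real mult_ac)
  qed
  also have "\<dots> = iexp (u * d) * ((1 - t + t * ?w) ^ Suc n * (1 - x + x * ?z) ^ n)"
    by (simp only: sum_Bernstein_power[symmetric] sum_product) (simp only: sum_distrib_left)
  \<comment> \<open>The phase of the shift splits into \<open>n\<close> centering factors for each
    variable.\<close>
  also have "iexp (u * d) = iexp (t * ?h) ^ n * iexp (- (x * ?h)) ^ n"
    by (simp add: d algebra_simps flip: exp_add exp_of_nat_mult)
  also have "\<dots> * ((1 - t + t * ?w) ^ Suc n * (1 - x + x * ?z) ^ n) =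
     ((1 - t + t * ?w) * iexp (- (t * - ?h))) ^ n * ((1 - x + x * ?z) * iexp (- (x * ?h))) ^ n *
      (1 - t + t * ?w)"
    by (simp add: power_mult_distrib mult_ac)
  finally show ?thesis
    by (simp only: centered_bernoulli_char_eq of_real_diff of_real_1)
qed

section \<open>Convergence of the distribution functions\<close>

theorem theorem1p2:
  fixes x :: real
  assumes "0 < x" and "x < 1"
  shows "weak_conv_m (\<lambda>n. scaled_durrmeyer n x)
           (density lborel (normal_density 0 (sqrt (2 * x * (1 - x)))))"
proof -
  define \<sigma> where "\<sigma> = sqrt (2 * x * (1 - x))"
  define N where "N = density lborel (normal_density 0 \<sigma>)"
  have \<sigma>: "\<sigma> > 0" "\<sigma>\<^sup>2 = 2 * x * (1 - x)" using assms by (auto simp: \<sigma>_def)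
  have x: "x \<in> {0..1}" using assms by auto
  interpret N: real_distribution N
    unfolding N_def real_distribution_def real_distribution_axioms_def
    using prob_space_normal_density[OF \<sigma>(1)] by simp
  have "(\<lambda>n. cdf (scaled_durrmeyer n x) s) \<longlonglongrightarrow> cdf N s" for s
  proof -
    define t where "t n = x + s / sqrt (real n)" for n
    define P where "P n = pair_pmf (binomial_pmf (Suc n) (t n)) (binomial_pmf n x)" for n
    define Z where "Z n = (\<lambda>(j, k). 1 / sqrt (real n) * (real k - real j) + s)" for n
    define D where "D n = distr (measure_pmf (P n)) borel (Z n)" for n
    have t_lim: "t \<longlonglongrightarrow> x" unfolding t_def by real_asymp
    \<comment> \<open>Since \<open>x\<close> is an interior point, the formula for the distribution
      function applies for all large \<open>n\<close>.\<close>
    have t01: "\<forall>\<^sub>F n in sequentially. t n \<in> {0..1}"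
      using order_tendstoD(1)[OF t_lim assms(1)] order_tendstoD(2)[OF t_lim assms(2)]
      by eventually_elim auto
    \<comment> \<open>Levy's theorem asks for a probability law at every \<open>n\<close>, including
      those with \<open>t n\<close> outside [0,1].\<close>
    have D: "real_distribution (D n)" for n
      unfolding D_def by (intro prob_space.real_distribution_distr measure_pmf.prob_space_axioms) auto
    have "(\<lambda>n. char (D n) u) \<longlonglongrightarrow> char N u" for u
    proof -
      let ?R = "\<lambda>n. centered_bernoulli_char (t n) (- u / sqrt (real n)) ^ n *
        centered_bernoulli_char x (u / sqrt (real n)) ^ n * (1 - t n + t n * iexp (- u / sqrt (real n)))"
      have "(\<lambda>n. - u / sqrt (real n)) \<longlonglongrightarrow> 0" by real_asymp
      \<comment> \<open>Each of the two powers contributes variance \<open>x * (1 - x)\<close>, and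
        the factor of the extra trial tends to 1.\<close>
      then have "?R \<longlonglongrightarrow> exp (of_real (- (x * (1 - x) * (- u)\<^sup>2 / 2))) *
          exp (of_real (- (x * (1 - x) * u\<^sup>2 / 2))) * (1 - x + x * iexp 0)"
        using x t01 t_lim
        by (intro tendsto_mult tendsto_centered_bernoulli_char_power tendsto_intros) auto
      also have "exp (of_real (- (x * (1 - x) * (- u)\<^sup>2 / 2))) *
          exp (of_real (- (x * (1 - x) * u\<^sup>2 / 2))) * (1 - x + x * iexp 0) = char N u"
        using \<sigma> by (simp add: N_def char_normal_density flip: exp_add)
      finally have "?R \<longlonglongrightarrow> char N u" .
      moreover have "\<forall>\<^sub>F n in sequentially. char (D n) u = ?R n"
        using t01 eventually_gt_at_top[of 0]
      proof eventually_elim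
        case (elim n)
        \<comment> \<open>With \<open>c = 1 / sqrt n\<close> the required centering shift is
          precisely \<open>s\<close>.\<close>
        have "s = 1 / sqrt (real n) * (real n * (t n - x))"
          using elim by (simp add: t_def real_div_sqrt)
        from char_binomial_difference[OF elim(1) x this, of u] show ?case
          by (simp add: D_def P_def Z_def)
      qed
      ultimately show ?thesis by (simp add: filterlim_cong)
    qed
    then have "weak_conv_m D N"
      using D N.real_distribution_axioms by (intro levy_continuity) auto
    \<comment> \<open>The event \<open>k < j\<close> corresponds to the open half-line below
      \<open>s\<close>. Its boundary point has measure 0 under \<open>N\<close>, so it is a
      continuity set, and its limit measure equals \<open>cdf N s\<close>.\<close>
    moreover have null: "measure N {s} = 0"
      by (auto simp: N_def measure_def emeasure_density nn_integral_null_set)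
    moreover have "frontier {..<s} = {s}"
      by (auto simp: frontier_def interior_open)
    ultimately have "(\<lambda>n. measure (D n) {..<s}) \<longlonglongrightarrow> measure N {..<s}"
      using D N.real_distribution_axioms
      by (intro weak_conv_imp_continuity_set_conv) (auto simp: N.emeasure_eq_measure)
    also have "measure N {..<s} = cdf N s"
      using N.finite_measure_Union[of "{..<s}" "{s}"] null
      by (simp add: cdf_def ivl_disj_un_singleton(2)[symmetric])
    finally have "(\<lambda>n. measure (D n) {..<s}) \<longlonglongrightarrow> cdf N s" .
    moreover have "\<forall>\<^sub>F n in sequentially. measure (D n) {..<s} = cdf (scaled_durrmeyer n x) s"
      using t01 eventually_gt_at_top[of 0]
    proof eventually_elim
      case (elim n)
      \<comment> \<open>The shift \<open>s\<close> cancels, leaving the sign of \<open>k - j\<close>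
        because \<open>sqrt n\<close> is positive.\<close>
      have "Z n -` {..<s} = {(j, k). k < j}"
        using elim by (auto simp: Z_def divide_less_0_iff)
      then have "measure (D n) {..<s} = measure_pmf.prob (P n) {(j, k). k < j}"
        by (simp add: D_def measure_distr)
      then show ?case
        using cdf_scaled_durrmeyer[OF x, of n s] elim by (simp add: P_def t_def)
    qed
    ultimately show ?thesis by (simp add: filterlim_cong)
  qed
  then show ?thesis
    by (simp add: weak_conv_m_def weak_conv_def N_def \<sigma>_def)
qed

end
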